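(* Let $k$ be an algebraically closed field of characteristic $0$, let $K/k$ be a field extension, and let $\upsilon:K^*\to G$ be a valuation that is trivial on $k$ (i.e. $\upsilon(k^* )=0$), where $G$ is a finitely generated ordered abelian group. Then $$\operatorname{trdeg}_k K\ \ge\ \operatorname{rank}\upsilon .$$
   Context: An ordered abelian group is an abelian group $G$ with a total order compatible with addition; if $G$ is finitely generated it is torsion free, so $G\cong\mathbb{Z}^n$ as a group for some $n$ (the order is not assumed to be lexicographic). A valuation on a field $K$ is a surjective map $\upsilon:K^*\to G$ onto a finitely generated ordered abelian group $G$ such that $\upsilon(xy)=\upsilon(x)+\upsilon(y)$ for all $x,y\in K^*$ and $\upsilon(x+y)\ge\min\{\upsilon(x),\upsilon(y)\}$ whenever $x+y\neq 0$. The rank of the valuation, $\operatorname{rank}\upsilon$, is defined to be the rank of $G$ as an abelian group (i.e. the $n$ with $G\cong\mathbb{Z}^n$). *)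

theory Defs
  imports
    "HOL-Algebra.Elementary_Groups"
    "HOL-Algebra.Generated_Groups"
    "HOL-Algebra.Product_Groups"
    "HOL-Library.Poly_Mapping"
    "HOL-Library.Extended_Nat"
    "HOL-Computational_Algebra.Polynomial"
begin

text \<open>
  A field extension \<open>K/k\<close> is given by two field types and a (necessarily injective) ring
  homomorphism \<open>\<iota> : k \<rightarrow> K\<close>.
\<close>

definition field_embedding :: "('k::field \<Rightarrow> 'a::field) \<Rightarrow> bool" where
  "field_embedding \<iota> \<longleftrightarrow>
     \<iota> 1 = 1 \<and> (\<forall>x y. \<iota> (x + y) = \<iota> x + \<iota> y) \<and> (\<forall>x y. \<iota> (x * y) = \<iota> x * \<iota> y)"

text \<open>
  Polynomials over \<open>k\<close> in commuting variables indexed by the elements of \<open>K\<close>: a monomial is a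
  finitely supported exponent function \<open>'a \<Rightarrow>\<^sub>0 nat\<close>, and a polynomial is a finitely supported
  function from monomials to coefficients. Such a polynomial is evaluated by substituting for
  each variable the element of \<open>K\<close> that indexes it.
\<close>

definition eval_mpoly ::
  "('k::field \<Rightarrow> 'a::field) \<Rightarrow> (('a \<Rightarrow>\<^sub>0 nat) \<Rightarrow>\<^sub>0 'k) \<Rightarrow> 'a" where
  "eval_mpoly \<iota> p =
     (\<Sum>m\<in>Poly_Mapping.keys p.
        \<iota> (Poly_Mapping.lookup p m) *
        (\<Prod>x\<in>Poly_Mapping.keys m. x ^ Poly_Mapping.lookup m x))"

definition mpoly_vars :: "(('a \<Rightarrow>\<^sub>0 nat) \<Rightarrow>\<^sub>0 'k::zero) \<Rightarrow> 'a set" where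
  "mpoly_vars p = (\<Union>m\<in>Poly_Mapping.keys p. Poly_Mapping.keys m)"

definition algebraically_independent :: "('k::field \<Rightarrow> 'a::field) \<Rightarrow> 'a set \<Rightarrow> bool" where
  "algebraically_independent \<iota> S \<longleftrightarrow>
     (\<forall>p. mpoly_vars p \<subseteq> S \<and> eval_mpoly \<iota> p = 0 \<longrightarrow> p = 0)"

text \<open>
  The transcendence degree is the largest cardinality of an algebraically independent subset,
  with all infinite cardinalities identified with \<open>\<infinity>\<close>.
\<close>

definition trdeg :: "('k::field \<Rightarrow> 'a::field) \<Rightarrow> enat" where
  "trdeg \<iota> =
     (SUP S \<in> {S. algebraically_independent \<iota> S}. if finite S then enat (card S) else \<infinity>)"

definition additive_group :: "'g::ab_group_add monoid" where
  "additive_group = \<lparr>carrier = UNIV, monoid.mult = (+), one = 0\<rparr>"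

definition finitely_generated_group :: "('b, 'c) monoid_scheme \<Rightarrow> bool" where
  "finitely_generated_group G \<longleftrightarrow>
     (\<exists>S. finite S \<and> S \<subseteq> carrier G \<and> generate G S = carrier G)"

text \<open>
  The rank of a finitely generated torsion free abelian group: the unique \<open>n\<close> such that the
  group is isomorphic to \<open>\<int>\<^sup>n\<close>. The value is unspecified for other groups.
\<close>

definition abelian_rank :: "('b, 'c) monoid_scheme \<Rightarrow> nat" where
  "abelian_rank G = (THE n. G \<cong> product_group {..<n} (\<lambda>_. integer_group))"

text \<open>
  Only the values of \<open>v\<close> on nonzero elements matter; \<open>v 0\<close> is unconstrained. The class
  \<open>linordered_ab_group_add\<close> is that of abelian groups with a compatible total order.
\<close>

definition valuation :: "('a::field \<Rightarrow> 'g::linordered_ab_group_add) \<Rightarrow> bool" where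
  "valuation v \<longleftrightarrow>
     finitely_generated_group (additive_group :: 'g monoid) \<and>
     v ` (UNIV - {0}) = UNIV \<and>
     (\<forall>x y. x \<noteq> 0 \<longrightarrow> y \<noteq> 0 \<longrightarrow> v (x * y) = v x + v y) \<and>
     (\<forall>x y. x \<noteq> 0 \<longrightarrow> y \<noteq> 0 \<longrightarrow> x + y \<noteq> 0 \<longrightarrow> v (x + y) \<ge> min (v x) (v y))"

definition valuation_rank :: "('a::field \<Rightarrow> 'g::linordered_ab_group_add) \<Rightarrow> nat" where
  "valuation_rank v = abelian_rank (additive_group :: 'g monoid)"

end

theory Submission
  imports Defs "HOL-Algebra.Free_Abelian_Groups"
begin

text \<open>
  A finitely generated ordered abelian group is torsion free, hence has a finite basis \<open>B\<close> over
  the integers, and its rank is \<open>card B\<close>. Because the valuation is surjective, each element of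
  \<open>B\<close> is the value of some nonzero element of \<open>K\<close>; let \<open>S\<close> consist of one such lift for each
  element of \<open>B\<close>. Then \<open>S\<close> is algebraically independent over \<open>k\<close>, which gives
  \<open>card B = card S \<le> trdeg\<close>.

  The independence of \<open>S\<close> rests on the ultrametric inequality. The value of a monomial in \<open>S\<close> is
  the corresponding integer combination of elements of \<open>B\<close>, so different monomials have
  different values (\<open>monomial_valuations_distinct\<close>), and nonzero coefficients from \<open>k\<close> do not
  change these values. In a finite sum of nonzero elements with pairwise different values, the
  term of least value cannot be cancelled by the others
  (\<open>sum_distinct_valuations_nonzero\<close>). Hence no nontrivial polynomial vanishes on \<open>S\<close>.

  The basis \<open>B\<close> is a generating set of least cardinality: a nontrivial relation among its
  elements could be reduced by the Euclidean algorithm to a relation \<open>c * s = 0\<close> with a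
  single term (\<open>minimal_spanning_set_no_relation\<close>). Torsion freeness then gives \<open>s = 0\<close>, so
  that \<open>s\<close> could be dropped from the generating set, against minimality. That \<open>card B\<close> is
  the rank needs also that the rank of a free abelian group is an invariant
  (\<open>abelian_rank_eqI\<close>).
\<close>

section \<open>Abelian groups as modules over the integers\<close>

text \<open>
  Integer multiples are expressed as powers in the group \<open>additive_group\<close>: the laws of powers in a
  commutative group are then exactly the module axioms, and the notions of span and linear
  dependence of modules become available for abelian groups.
\<close>

definition zscale :: "int \<Rightarrow> 'g::ab_group_add \<Rightarrow> 'g" where
  "zscale n g = g [^]\<^bsub>(additive_group :: 'g monoid)\<^esub> n"

lemma carrier_additive_group [simp]: "carrier additive_group = UNIV"
  and mult_additive_group [simp]: "x \<otimes>\<^bsub>additive_group\<^esub> y = x + y"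
  and one_additive_group [simp]: "\<one>\<^bsub>additive_group\<^esub> = 0"
  by (simp_all add: additive_group_def)

lemma comm_group_additive_group: "comm_group (additive_group :: 'g::ab_group_add monoid)"
proof (rule comm_groupI)
  fix x :: 'g
  show "\<exists>y\<in>carrier additive_group. y \<otimes>\<^bsub>additive_group\<^esub> x = \<one>\<^bsub>additive_group\<^esub>"
    by (rule bexI[of _ "- x"]) simp_all
qed (simp_all add: algebra_simps)

lemma inv_additive_group [simp]: "inv\<^bsub>additive_group\<^esub> x = - (x :: 'g::ab_group_add)"
  using comm_group_additive_group[where 'g='g]
  by (intro group.inv_equality) (auto simp: comm_group_def)

interpretation zmod: Modules.module "zscale :: int \<Rightarrow> 'g \<Rightarrow> 'g::ab_group_add"
proof -
  interpret comm_group "additive_group :: 'g monoid" by (rule comm_group_additive_group)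
  show "Modules.module (zscale :: int \<Rightarrow> 'g \<Rightarrow> 'g)"
  proof
    fix a b :: int and x y :: 'g
    show "zscale a (x + y) = zscale a x + zscale a y"
      using int_pow_distrib[of x y a] by (simp add: zscale_def)
    show "zscale (a + b) x = zscale a x + zscale b x"
      using int_pow_mult[of x a b] by (simp add: zscale_def)
    show "zscale a (zscale b x) = zscale (a * b) x"
      using int_pow_pow[of x b a] by (simp add: zscale_def mult.commute)
    show "zscale 1 x = x"
      using int_pow_1[of x] by (simp add: zscale_def)
  qed
qed

lemma generate_additive_group_subset_span:
  "generate additive_group S \<subseteq> zmod.span S"
proof
  fix x assume "x \<in> generate additive_group S"
  then show "x \<in> zmod.span S"
    by induction (auto intro: zmod.span_base zmod.span_add zmod.span_neg zmod.span_zero)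
qed

lemma spanning_transfer:
  assumes "zmod.span S = UNIV" "S \<subseteq> zmod.span T"
  shows "zmod.span T = UNIV"
  using zmod.span_minimal[OF assms(2)] assms(1) by auto

section \<open>Bases of finitely generated ordered abelian groups\<close>

lemma zscale_pos:
  fixes g :: "'g::linordered_ab_group_add"
  assumes "0 < n" "0 < g"
  shows "0 < zscale n g"
  using assms(1)
proof (induction n rule: int_gr_induct)
  case base
  then show ?case using assms(2) by simp
next
  case (step i)
  then show ?case using assms(2) by (simp add: zmod.scale_left_distrib add_pos_pos)
qed

text \<open>
  The order makes the group torsion free: up to signs, a multiple of a nonzero element is a
  positive multiple of a positive element.
\<close>

lemma zscale_eq_0_iff:
  fixes g :: "'g::linordered_ab_group_add"
  shows "zscale n g = 0 \<longleftrightarrow> n = 0 \<or> g = 0"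
proof -
  have "zscale n g \<noteq> 0" if "n \<noteq> 0" "g \<noteq> 0"
  proof -
    have "0 < zscale \<bar>n\<bar> (if 0 < g then g else - g)"
      using that by (intro zscale_pos) (auto simp: not_less order_less_le)
    then show ?thesis
      by (auto simp: abs_if split: if_splits)
  qed
  then show ?thesis by auto
qed

text \<open>
  This is Euclidean descent on the sum of the absolute values of the coefficients. If two
  coefficients are nonzero, replacing the generator with the smaller coefficient by its sum
  with \<open>\<plusminus>\<close> the other generator subtracts the smaller coefficient from the larger one in absolute
  value. Minimality makes every generator irredundant, which serves twice: the new generator
  is not already present, so the cardinality stays the same, and a relation with only one nonzero
  coefficient, which would force that generator to be \<open>0\<close>, cannot occur.
\<close>

lemma minimal_spanning_set_no_relation:
  fixes S :: "'g::linordered_ab_group_add set"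
  assumes "finite S" and "zmod.span S = UNIV"
    and minimal: "\<And>T. finite T \<Longrightarrow> zmod.span T = (UNIV :: 'g set) \<Longrightarrow> card S \<le> card T"
    and "(\<Sum>s\<in>S. zscale (u s) s) = 0"
  shows "\<forall>s\<in>S. u s = 0"
  using assms
proof (induction "nat (\<Sum>s\<in>S. \<bar>u s\<bar>)" arbitrary: S u rule: less_induct)
  case less
  note fin = less.prems(1) and spans = less.prems(2) and minimal = less.prems(3)
    and rel = less.prems(4)
  have irredundant: "s \<notin> zmod.span (S - {s})" if "s \<in> S" for s
  proof
    assume "s \<in> zmod.span (S - {s})"
    then have "S \<subseteq> zmod.span (S - {s})"
      using zmod.span_superset[of "S - {s}"] by auto
    then have "zmod.span (S - {s}) = UNIV" by (rule spanning_transfer[OF spans])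
    then have "card S \<le> card (S - {s})" by (intro minimal) (use fin in auto)
    with card_Diff1_less[OF fin that] show False by simp
  qed
  show ?case
  proof (rule ccontr)
    assume "\<not> ?case"
    then obtain s where s: "s \<in> S" "u s \<noteq> 0" by blast
    have "\<exists>t\<in>S. t \<noteq> s \<and> u t \<noteq> 0"
    proof (rule ccontr)
      assume "\<not> ?thesis"
      then have "(\<Sum>t\<in>S. zscale (u t) t) = zscale (u s) s"
        using fin s by (subst sum.remove[of _ s]) (auto intro!: sum.neutral)
      then have "s = 0" using rel s zscale_eq_0_iff by metis
      then show False using irredundant[OF s(1)] zmod.span_zero by blast
    qed
    then obtain t where t: "t \<in> S" "t \<noteq> s" "u t \<noteq> 0" by blast
    obtain a b where ab: "a \<in> S" "b \<in> S" "a \<noteq> b" "u b \<noteq> 0" "\<bar>u b\<bar> \<le> \<bar>u a\<bar>"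
      using s t by (metis linear)
    \<comment> \<open>With this sign, subtracting \<open>e * u b\<close> moves \<open>u a\<close> towards zero without overshooting.\<close>
    define e where "e = sgn (u a) * sgn (u b)"
    have shrink: "\<bar>u a - e * u b\<bar> < \<bar>u a\<bar>"
      using ab(4,5) by (auto simp: e_def sgn_if abs_if split: if_splits)
    define c where "c = b + zscale e a"
    define R where "R = S - {a, b}"
    have S: "S = insert a (insert b R)" and R: "finite R" "a \<notin> R" "b \<notin> R"
      using ab fin by (auto simp: R_def)
    have b: "b = c - zscale e a" by (simp add: c_def)
    have c_notin: "c \<notin> insert a R"
    proof
      assume "c \<in> insert a R"
      then have "b \<in> zmod.span (insert a R)"
        unfolding b by (intro zmod.span_diff zmod.span_scale zmod.span_base) auto
      moreover have "S - {b} = insert a R" using S R ab by auto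
      ultimately show False using irredundant[OF ab(2)] by simp
    qed
    define T where "T = insert a (insert c R)"
    \<comment> \<open>The relation is rewritten by \<open>u a * a + u b * b = (u a - e * u b) * a + u b * (b + e * a)\<close>.\<close>
    define w where "w = u(c := u b, a := u a - e * u b)"
    have fT: "finite T" and card_T: "card T = card S"
      using R ab c_notin by (auto simp: T_def S)
    have w: "w a = u a - e * u b" "w c = u b" "\<And>r. r \<in> R \<Longrightarrow> w r = u r"
      using c_notin R by (auto simp: w_def)
    have "b \<in> zmod.span T"
      unfolding b by (intro zmod.span_diff zmod.span_scale zmod.span_base) (auto simp: T_def)
    then have "S \<subseteq> zmod.span T"
      using zmod.span_superset[of T] by (auto simp: S T_def)
    then have span_T: "zmod.span T = UNIV" by (rule spanning_transfer[OF spans])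
    have w_R: "(\<Sum>r\<in>R. zscale (w r) r) = (\<Sum>r\<in>R. zscale (u r) r)"
      "(\<Sum>r\<in>R. \<bar>w r\<bar>) = (\<Sum>r\<in>R. \<bar>u r\<bar>)"
      by (simp_all add: w(3))
    have "a \<notin> insert c R" "c \<notin> R" using R c_notin by auto
    note T_simps = this \<open>finite R\<close> w(1,2) w_R
    have "(\<Sum>t\<in>T. zscale (w t) t)
        = zscale (u a - e * u b) a + (zscale (u b) c + (\<Sum>r\<in>R. zscale (u r) r))"
      unfolding T_def using T_simps by simp
    also have "\<dots> = (\<Sum>s\<in>S. zscale (u s) s)"
      using R ab by (simp add: S c_def algebra_simps zmod.scale_left_diff_distrib
          zmod.scale_right_distrib)
    finally have rel_T: "(\<Sum>t\<in>T. zscale (w t) t) = 0" using rel by simp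
    have "(\<Sum>t\<in>T. \<bar>w t\<bar>) = \<bar>u a - e * u b\<bar> + (\<bar>u b\<bar> + (\<Sum>r\<in>R. \<bar>u r\<bar>))"
      unfolding T_def using T_simps by simp
    moreover have "(\<Sum>s\<in>S. \<bar>u s\<bar>) = \<bar>u a\<bar> + (\<bar>u b\<bar> + (\<Sum>r\<in>R. \<bar>u r\<bar>))"
      using R ab by (simp add: S)
    moreover have "0 \<le> (\<Sum>t\<in>T. \<bar>w t\<bar>)" by (simp add: sum_nonneg)
    ultimately have "nat (\<Sum>t\<in>T. \<bar>w t\<bar>) < nat (\<Sum>s\<in>S. \<bar>u s\<bar>)"
      using shrink by linarith
    then have "\<forall>t\<in>T. w t = 0"
      by (rule less.hyps[OF _ fT span_T _ rel_T]) (simp add: card_T minimal)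
    then show False using w(2) ab(4) by (auto simp: T_def)
  qed
qed

lemma finite_basis_exists:
  assumes "finitely_generated_group (additive_group :: 'g::linordered_ab_group_add monoid)"
  obtains B :: "'g::linordered_ab_group_add set"
    where "finite B" "zmod.span B = UNIV" "\<not> zmod.dependent B"
proof -
  define P where "P B \<longleftrightarrow> finite B \<and> zmod.span B = UNIV" for B :: "'g set"
  obtain S :: "'g set" where "finite S" "generate additive_group S = UNIV"
    using assms by (auto simp: finitely_generated_group_def)
  then have "P S" using generate_additive_group_subset_span[of S] by (auto simp: P_def)
  then obtain B where "P B" and minimal: "\<And>T. P T \<Longrightarrow> card B \<le> card T"
    using ex_has_least_nat[of P S card] by blast
  have "\<forall>b\<in>B. u b = 0" if "(\<Sum>b\<in>B. zscale (u b) b) = 0" for u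
    using minimal_spanning_set_no_relation[of B u] \<open>P B\<close> minimal that by (auto simp: P_def)
  then have "\<not> zmod.dependent B"
    using \<open>P B\<close> by (auto simp: P_def zmod.dependent_finite)
  then show thesis using that \<open>P B\<close> by (auto simp: P_def)
qed

section \<open>The rank as the cardinality of a basis\<close>

lemma product_integer_group_iso_free_Abelian_group:
  assumes "finite I"
  shows "product_group I (\<lambda>_. integer_group) \<cong> free_Abelian_group I"
proof -
  let ?P = "product_group I (\<lambda>_. integer_group)"
  interpret group ?P by simp
  have "sum_group I (\<lambda>_. integer_group) = subgroup_generated ?P (carrier ?P)"
    unfolding sum_group_def using assms by simp
  also have "\<dots> = ?P"
    by (rule subgroup_generated_group_carrier)
  finally show ?thesis using isomorphic_sum_integer_group[of I] by simp
qed

text \<open>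
  The definite description in \<open>abelian_rank\<close> is justified by passing to free abelian groups, which
  are isomorphic only if their sets of generators are equipotent.
\<close>

lemma abelian_rank_eqI:
  fixes G :: "('b, 'c) monoid_scheme"
  assumes "group G" and iso: "product_group {..<n} (\<lambda>_. integer_group) \<cong> G"
  shows "abelian_rank G = n"
  unfolding abelian_rank_def
proof (rule the_equality)
  show "G \<cong> product_group {..<n} (\<lambda>_. integer_group)"
    using iso by (rule group.iso_sym[rotated]) simp
next
  fix m :: nat
  assume "G \<cong> product_group {..<m} (\<lambda>_. integer_group)"
  with iso have iso_nm:
    "product_group {..<n} (\<lambda>_. integer_group) \<cong> product_group {..<m} (\<lambda>_. integer_group)"
    by (rule iso_trans)
  have "free_Abelian_group {..<n} \<cong> product_group {..<n} (\<lambda>_. integer_group)"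
    by (rule group.iso_sym) (simp_all add: product_integer_group_iso_free_Abelian_group)
  also note iso_nm
  also have "product_group {..<m} (\<lambda>_. integer_group) \<cong> free_Abelian_group {..<m}"
    by (simp add: product_integer_group_iso_free_Abelian_group)
  finally have "{..<n} \<approx> {..<m}" by (simp add: isomorphic_free_Abelian_groups)
  then show "m = n" by (metis card_lessThan eqpoll_iff_card finite_lessThan)
qed

lemma abelian_rank_eq_card_basis:
  fixes B :: "'g::ab_group_add set"
  assumes "finite B" and spans: "zmod.span B = UNIV" and indep: "\<not> zmod.dependent B"
  shows "abelian_rank (additive_group :: 'g monoid) = card B"
proof (rule abelian_rank_eqI)
  show "group (additive_group :: 'g monoid)"
    using comm_group_additive_group by (rule comm_group.axioms(2))
  obtain b where b: "bij_betw b {..<card B} B"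
    using ex_bij_betw_nat_finite[OF assms(1)] by (auto simp: atLeast0LessThan)
  let ?n = "card B"
  let ?P = "product_group {..<?n} (\<lambda>_. integer_group)"
  define h where "h f = (\<Sum>i<?n. zscale (f i) (b i))" for f
  have h_diff: "h (\<lambda>i. f i - g i) = h f - h g" for f g
    by (simp add: h_def zmod.scale_left_diff_distrib sum_subtractf)
  have kernel: "f i = 0" if "h f = 0" "i < ?n" for f i
  proof -
    define u where "u = f \<circ> the_inv_into {..<?n} b"
    have u: "u (b j) = f j" if "j < ?n" for j
      using b that by (simp add: u_def the_inv_into_f_f bij_betw_def)
    have "(\<Sum>x\<in>B. zscale (u x) x) = h f"
      unfolding h_def using u by (subst sum.reindex_bij_betw[OF b, symmetric]) simp
    then have "\<forall>x\<in>B. u x = 0"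
      using that(1) indep zmod.dependent_finite[OF assms(1)] by metis
    then show ?thesis using u[OF that(2)] b that(2) by (force simp: bij_betw_def)
  qed
  have "h \<in> iso ?P additive_group"
  proof (rule isoI)
    show "h \<in> hom ?P additive_group"
      by (rule homI) (simp_all add: h_def zmod.scale_left_distrib sum.distrib)
    have "inj_on h (carrier ?P)"
    proof (rule inj_onI)
      fix f g assume "f \<in> carrier ?P" "g \<in> carrier ?P" "h f = h g"
      moreover from this have "f i = g i" if "i < ?n" for i
        using kernel[of "\<lambda>i. f i - g i"] h_diff[of f g] that by simp
      ultimately show "f = g" by (auto intro: PiE_ext)
    qed
    moreover have "x \<in> h ` carrier ?P" for x
    proof -
      have "x \<in> zmod.span B" using spans by simp
      then obtain u where "x = (\<Sum>y\<in>B. zscale (u y) y)"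
        using zmod.span_finite[OF assms(1)] by auto
      also have "\<dots> = h (\<lambda>i\<in>{..<?n}. u (b i))"
        unfolding h_def by (subst sum.reindex_bij_betw[OF b, symmetric]) simp
      finally show ?thesis by auto
    qed
    ultimately show "bij_betw h (carrier ?P) (carrier additive_group)"
      by (auto simp: bij_betw_def)
  qed
  then show "?P \<cong> (additive_group :: 'g monoid)" by (rule is_isoI)
qed

section \<open>Valuations and sums\<close>

context
  fixes v :: "'a::field \<Rightarrow> 'g::linordered_ab_group_add"
  assumes val: "valuation v"
begin

lemma valuation_mult: "x \<noteq> 0 \<Longrightarrow> y \<noteq> 0 \<Longrightarrow> v (x * y) = v x + v y"
  using val by (simp add: valuation_def)

lemma valuation_add: "x \<noteq> 0 \<Longrightarrow> y \<noteq> 0 \<Longrightarrow> x + y \<noteq> 0 \<Longrightarrow> min (v x) (v y) \<le> v (x + y)"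
  using val by (simp add: valuation_def)

lemma valuation_1: "v 1 = 0"
  using valuation_mult[of 1 1] by simp

text \<open>
  Since \<open>v (- 1)\<close> doubled is \<open>v 1 = 0\<close>, it vanishes in an ordered group.
\<close>

lemma valuation_minus:
  assumes "x \<noteq> 0"
  shows "v (- x) = v x"
proof -
  have "v (- 1) + v (- 1) = 0" using valuation_mult[of "- 1" "- 1"] valuation_1 by simp
  then have "v (- 1) = 0" by simp
  then show ?thesis using valuation_mult[of "- 1" x] assms by simp
qed

lemma valuation_power: "x \<noteq> 0 \<Longrightarrow> v (x ^ n) = zscale (int n) (v x)"
  by (induction n) (simp_all add: valuation_1 valuation_mult zmod.scale_left_distrib)

lemma valuation_prod:
  assumes "\<And>i. i \<in> I \<Longrightarrow> f i \<noteq> 0"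
  shows "v (\<Prod>i\<in>I. f i) = (\<Sum>i\<in>I. v (f i))"
  using assms by (induction I rule: infinite_finite_induct) (simp_all add: valuation_1 valuation_mult)

text \<open>
  If the value of the sum exceeded \<open>v x\<close>, then writing \<open>x = (x + y) + (- y)\<close> as a sum of two
  elements of value greater than \<open>v x\<close> would contradict the ultrametric inequality.
\<close>

lemma valuation_add_less:
  assumes "x \<noteq> 0" "y \<noteq> 0" "v x < v y"
  shows "x + y \<noteq> 0 \<and> v (x + y) = v x"
proof
  show nz: "x + y \<noteq> 0"
    using assms valuation_minus by (metis add_eq_0_iff2 less_irrefl)
  have "v x \<le> v (x + y)" using valuation_add[of x y] assms nz by simp
  moreover have "\<not> v x < v (x + y)"
    using valuation_add[of "x + y" "- y"] valuation_minus[of y] assms nz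
    by (auto simp: min_le_iff_disj)
  ultimately show "v (x + y) = v x" by simp
qed

text \<open>
  The clause that the value of the sum is attained by one of the terms is what carries the
  induction: a new term then has a value different from that of the sum so far, and
  \<open>valuation_add_less\<close> applies in one order or the other.
\<close>

lemma sum_distinct_valuations_nonzero:
  assumes "finite I" "I \<noteq> {}" "\<And>i. i \<in> I \<Longrightarrow> f i \<noteq> 0" "inj_on (\<lambda>i. v (f i)) I"
  shows "(\<Sum>i\<in>I. f i) \<noteq> 0 \<and> (\<exists>i\<in>I. v (\<Sum>i\<in>I. f i) = v (f i))"
  using assms
proof (induction I rule: finite_ne_induct)
  case (singleton i)
  then show ?case by simp
next
  case (insert j I)
  then obtain i where i: "i \<in> I" "(\<Sum>i\<in>I. f i) \<noteq> 0" "v (\<Sum>i\<in>I. f i) = v (f i)"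
    by (auto simp: inj_on_def)
  have "v (f j) \<noteq> v (\<Sum>i\<in>I. f i)" using insert i by (auto simp: inj_on_def)
  then consider "v (f j) < v (\<Sum>i\<in>I. f i)" | "v (\<Sum>i\<in>I. f i) < v (f j)"
    by (auto simp: neq_iff)
  then show ?case
  proof cases
    case 1
    then show ?thesis using valuation_add_less[of "f j" "\<Sum>i\<in>I. f i"] i insert by simp
  next
    case 2
    then show ?thesis using valuation_add_less[of "\<Sum>i\<in>I. f i" "f j"] i insert
      by (auto simp: add.commute)
  qed
qed

section \<open>Algebraic independence from independent values\<close>

text \<open>
  Summing over a set \<open>T\<close> larger than the support allows two monomials with different supports
  to be compared coefficient by coefficient.
\<close>

lemma valuation_monomial:
  assumes "0 \<notin> Poly_Mapping.keys m"
    and "finite T" "Poly_Mapping.keys m \<subseteq> T"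
  shows "v (\<Prod>x\<in>Poly_Mapping.keys m. x ^ Poly_Mapping.lookup m x)
       = (\<Sum>x\<in>T. zscale (int (Poly_Mapping.lookup m x)) (v x))"
proof -
  have "v (\<Prod>x\<in>Poly_Mapping.keys m. x ^ Poly_Mapping.lookup m x)
      = (\<Sum>x\<in>Poly_Mapping.keys m. v (x ^ Poly_Mapping.lookup m x))"
    using assms(1) by (intro valuation_prod) auto
  also have "\<dots> = (\<Sum>x\<in>Poly_Mapping.keys m. zscale (int (Poly_Mapping.lookup m x)) (v x))"
    using assms(1) by (intro sum.cong refl valuation_power) auto
  also have "\<dots> = (\<Sum>x\<in>T. zscale (int (Poly_Mapping.lookup m x)) (v x))"
    using assms(2,3) by (intro sum.mono_neutral_left) (auto simp: in_keys_iff)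
  finally show ?thesis .
qed

text \<open>
  Two monomials of equal value give a relation among the values of the variables, whose
  coefficients are the differences of the exponents.
\<close>

lemma monomial_valuations_distinct:
  assumes "0 \<notin> S" "inj_on v S" "\<not> zmod.dependent (v ` S)"
  shows "inj_on (\<lambda>m. v (\<Prod>x\<in>Poly_Mapping.keys m. x ^ Poly_Mapping.lookup m x))
           {m. Poly_Mapping.keys m \<subseteq> S}"
proof (rule inj_onI, clarify)
  fix m m' :: "'a \<Rightarrow>\<^sub>0 nat"
  assume m: "Poly_Mapping.keys m \<subseteq> S" and m': "Poly_Mapping.keys m' \<subseteq> S"
    and eq: "v (\<Prod>x\<in>Poly_Mapping.keys m. x ^ Poly_Mapping.lookup m x)
           = v (\<Prod>x\<in>Poly_Mapping.keys m'. x ^ Poly_Mapping.lookup m' x)"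
  define T where "T = Poly_Mapping.keys m \<union> Poly_Mapping.keys m'"
  define d where "d x = int (Poly_Mapping.lookup m x) - int (Poly_Mapping.lookup m' x)" for x
  have T: "finite T" "T \<subseteq> S" using m m' by (auto simp: T_def)
  have inj: "inj_on v T" using assms(2) T(2) by (rule inj_on_subset)
  have "0 \<notin> Poly_Mapping.keys m" "0 \<notin> Poly_Mapping.keys m'" using assms(1) m m' by auto
  then have "(\<Sum>x\<in>T. zscale (d x) (v x)) = 0"
    using eq T(1) by (simp add: valuation_monomial[of _ T] T_def d_def
        zmod.scale_left_diff_distrib sum_subtractf)
  then have "(\<Sum>g\<in>v ` T. zscale ((d \<circ> the_inv_into T v) g) g) = 0"
    using inj by (simp add: sum.reindex the_inv_into_f_f)
  note zmod.independentD[OF assms(3) finite_imageI[OF T(1)] image_mono[OF T(2)] this]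
  then have "d x = 0" if "x \<in> T" for x
    using inj that by (fastforce simp: the_inv_into_f_f)
  then show "m = m'"
    by (intro poly_mapping_eqI) (metis T_def UnCI d_def eq_iff_diff_eq_0 in_keys_iff of_nat_eq_iff)
qed

text \<open>
  Each term of a polynomial in \<open>S\<close> has the value of its monomial, because the valuation is trivial on
  the coefficients. The terms thus have pairwise different values and cannot sum to zero.
\<close>

lemma independent_valuations_imp_algebraically_independent:
  fixes \<iota> :: "'k::field \<Rightarrow> 'a"
  assumes "field_embedding \<iota>" and trivial: "\<And>c. c \<noteq> 0 \<Longrightarrow> v (\<iota> c) = 0"
    and S: "0 \<notin> S" "inj_on v S" "\<not> zmod.dependent (v ` S)"
  shows "algebraically_independent \<iota> S"
  unfolding algebraically_independent_def
proof (intro allI impI, elim conjE, rule ccontr)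
  fix p :: "('a \<Rightarrow>\<^sub>0 nat) \<Rightarrow>\<^sub>0 'k"
  assume vars: "mpoly_vars p \<subseteq> S" and root: "eval_mpoly \<iota> p = 0" and "p \<noteq> 0"
  define mon where
    "mon m = (\<Prod>x\<in>Poly_Mapping.keys m. x ^ Poly_Mapping.lookup m x)" for m :: "'a \<Rightarrow>\<^sub>0 nat"
  have embed: "\<iota> c \<noteq> 0" if "c \<noteq> 0" for c
  proof
    assume "\<iota> c = 0"
    then have "\<iota> (c * inverse c) = 0" using assms(1) by (simp add: field_embedding_def)
    then show False using assms(1) that by (simp add: field_embedding_def)
  qed
  have keys: "Poly_Mapping.keys m \<subseteq> S" if "m \<in> Poly_Mapping.keys p" for m
    using vars that by (auto simp: mpoly_vars_def)
  have mon_nz: "mon m \<noteq> 0" if "m \<in> Poly_Mapping.keys p" for m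
    using keys[OF that] S(1) by (auto simp: mon_def)
  have coeff: "Poly_Mapping.lookup p m \<noteq> 0" if "m \<in> Poly_Mapping.keys p" for m
    using that by (simp add: in_keys_iff)
  have term_val: "v (\<iota> (Poly_Mapping.lookup p m) * mon m) = v (mon m)"
    if "m \<in> Poly_Mapping.keys p" for m
    using valuation_mult[OF embed mon_nz] coeff trivial that by simp
  have "inj_on (\<lambda>m. v (mon m)) (Poly_Mapping.keys p)"
    unfolding mon_def
    by (rule inj_on_subset[OF monomial_valuations_distinct[OF S]]) (use keys in auto)
  then have "inj_on (\<lambda>m. v (\<iota> (Poly_Mapping.lookup p m) * mon m)) (Poly_Mapping.keys p)"
    using term_val by (simp cong: inj_on_cong)
  then have "(\<Sum>m\<in>Poly_Mapping.keys p. \<iota> (Poly_Mapping.lookup p m) * mon m) \<noteq> 0"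
    using sum_distinct_valuations_nonzero[of "Poly_Mapping.keys p"
        "\<lambda>m. \<iota> (Poly_Mapping.lookup p m) * mon m"] \<open>p \<noteq> 0\<close> embed coeff mon_nz by simp
  then show False using root by (simp add: eval_mpoly_def mon_def)
qed

end

section \<open>Transcendence degree and rank\<close>

lemma card_le_trdeg:
  assumes "finite S" "algebraically_independent \<iota> S"
  shows "enat (card S) \<le> trdeg \<iota>"
  unfolding trdeg_def using assms by (intro SUP_upper2[of S]) auto

theorem theorem3p1:
  fixes \<iota> :: "'k::{alg_closed_field, field_char_0} \<Rightarrow> 'a::field"
    and v :: "'a \<Rightarrow> 'g::linordered_ab_group_add"
  assumes "field_embedding \<iota>"
    and "valuation v"
    and "\<And>c. c \<noteq> 0 \<Longrightarrow> v (\<iota> c) = 0"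
  shows "trdeg \<iota> \<ge> enat (valuation_rank v)"
proof -
  have "finitely_generated_group (additive_group :: 'g monoid)"
    and surj: "v ` (UNIV - {0}) = UNIV"
    using assms(2) by (simp_all add: valuation_def)
  then obtain B :: "'g set"
    where B: "finite B" "zmod.span B = UNIV" "\<not> zmod.dependent B"
    using finite_basis_exists by blast
  obtain S where S: "S \<subseteq> UNIV - {0}" "inj_on v S" "v ` S = B"
    using surj subset_image_inj[of B v "UNIV - {0}"] by auto
  have "algebraically_independent \<iota> S"
    using independent_valuations_imp_algebraically_independent[OF assms(2,1,3)] S B by auto
  moreover have "finite S" using S B(1) finite_imageD[of v S] by simp
  moreover have "card S = card B" using S card_image[of v S] by simp
  ultimately show ?thesis
    using card_le_trdeg[of S \<iota>] abelian_rank_eq_card_basis[OF B] by (simp add: valuation_rank_def)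
qed

end
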